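(* Let $\mathbb K$ be an algebraically closed field of characteristic $2$ and let $\mathfrak g=\mathfrak o_I^{(1)}(4)$, with basis $F_{ij}=E^{i,j}+E^{j,i}$, $1\le i<j\le4$. Then $H^2(\mathfrak g;\mathfrak g)$ is spanned by the classes of the following cocycles: $c_1=F_{13}\otimes\hat F_{12}\wedge\hat F_{23}+F_{14}\otimes\hat F_{12}\wedge\hat F_{24}+F_{34}\otimes\hat F_{23}\wedge\hat F_{24}$, $c_2=F_{13}\otimes\hat F_{23}\wedge\hat F_{34}+F_{23}\otimes\hat F_{13}\wedge\hat F_{34}+F_{34}\otimes\hat F_{13}\wedge\hat F_{23}$, $c_3=F_{12}\otimes\hat F_{13}\wedge\hat F_{23}+F_{14}\otimes\hat F_{13}\wedge\hat F_{34}+F_{24}\otimes\hat F_{23}\wedge\hat F_{34}$, $c_4=F_{12}\otimes\hat F_{23}\wedge\hat F_{24}+F_{23}\otimes\hat F_{12}\wedge\hat F_{24}+F_{24}\otimes\hat F_{12}\wedge\hat F_{23}$, $c_5=F_{12}\otimes\hat F_{13}\wedge\hat F_{14}+F_{13}\otimes\hat F_{12}\wedge\hat F_{14}+F_{14}\otimes\hat F_{12}\wedge\hat F_{13}$, $c_6=F_{12}\otimes\hat F_{14}\wedge\hat F_{24}+F_{13}\otimes\hat F_{14}\wedge\hat F_{34}+F_{23}\otimes\hat F_{24}\wedge\hat F_{34}$.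
   Context: $\mathfrak o_I(n)$ is the Lie algebra of $n\times n$ matrices over $\mathbb K$ preserving the symmetric bilinear form with Gram matrix $1_n$, i.e. (in characteristic $2$) the Lie algebra of symmetric $n\times n$ matrices under the commutator; $\mathfrak o_I^{(1)}(n)$ is its derived algebra, consisting of the symmetric matrices with zero diagonal. $E^{i,j}$ is the matrix unit. $H^2(\mathfrak g;\mathfrak g)$ is Chevalley--Eilenberg cohomology (with alternating cochains) with coefficients in the adjoint module. $\hat F_{ij}$ are the elements of the basis dual to $(F_{ij})_{i<j}$, and $u\otimes\hat v\wedge\hat w$ is the cochain $(X,Y)\mapsto(\hat v(X)\hat w(Y)+\hat v(Y)\hat w(X))u$. *)

theory Defs
  imports
    "HOL-Analysis.Analysis"
    "HOL-Library.Function_Algebras"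
    "HOL-Library.Set_Algebras"
begin

section \<open>Lie algebras and their second cohomology with adjoint coefficients\<close>

text \<open>
  A Lie algebra is given by a subspace \<open>L\<close> of an ambient vector space. In characteristic 2 the
  condition \<open>br x x = 0\<close> is part of the definition; antisymmetry alone would be too weak.
\<close>

locale lie_algebra = vector_space scale
  for scale :: "'k::field \<Rightarrow> 'v::ab_group_add \<Rightarrow> 'v" (infixr \<open>*s\<close> 75) +
  fixes L :: "'v set"
    and br :: "'v \<Rightarrow> 'v \<Rightarrow> 'v"
  assumes subspace_L: "subspace L"
    and br_closed: "x \<in> L \<Longrightarrow> y \<in> L \<Longrightarrow> br x y \<in> L"
    and br_add_left: "x \<in> L \<Longrightarrow> y \<in> L \<Longrightarrow> z \<in> L \<Longrightarrow> br (x + y) z = br x z + br y z"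
    and br_add_right: "x \<in> L \<Longrightarrow> y \<in> L \<Longrightarrow> z \<in> L \<Longrightarrow> br x (y + z) = br x y + br x z"
    and br_scale_left: "x \<in> L \<Longrightarrow> y \<in> L \<Longrightarrow> br (r *s x) y = r *s br x y"
    and br_scale_right: "x \<in> L \<Longrightarrow> y \<in> L \<Longrightarrow> br x (r *s y) = r *s br x y"
    and br_self: "x \<in> L \<Longrightarrow> br x x = 0"
    and jacobi: "x \<in> L \<Longrightarrow> y \<in> L \<Longrightarrow> z \<in> L \<Longrightarrow>
      br x (br y z) + br y (br z x) + br z (br x y) = 0"
begin

definition derived :: "'v set" where
  "derived = span {br x y | x y. x \<in> L \<and> y \<in> L}"

definition linear_on_L :: "('v \<Rightarrow> 'v) \<Rightarrow> bool" where
  "linear_on_L f \<longleftrightarrow>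
     (\<forall>x\<in>L. \<forall>y\<in>L. f (x + y) = f x + f y) \<and> (\<forall>r. \<forall>x\<in>L. f (r *s x) = r *s f x)"

text \<open>
  Cochains are maps on \<open>L\<close>, represented by functions on the ambient type that vanish when some
  argument is outside \<open>L\<close>; so equality of functions is equality of cochains.
\<close>

definition C1 :: "('v \<Rightarrow> 'v) set" where
  "C1 = {f. linear_on_L f \<and> (\<forall>x\<in>L. f x \<in> L) \<and> (\<forall>x. x \<notin> L \<longrightarrow> f x = 0)}"

definition C2 :: "('v \<Rightarrow> 'v \<Rightarrow> 'v) set" where
  "C2 = {c. (\<forall>y\<in>L. linear_on_L (\<lambda>x. c x y)) \<and> (\<forall>x\<in>L. linear_on_L (c x)) \<and>
            (\<forall>x\<in>L. c x x = 0) \<and> (\<forall>x\<in>L. \<forall>y\<in>L. c x y \<in> L) \<and>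
            (\<forall>x y. x \<notin> L \<or> y \<notin> L \<longrightarrow> c x y = 0)}"

definition d1 :: "('v \<Rightarrow> 'v) \<Rightarrow> 'v \<Rightarrow> 'v \<Rightarrow> 'v" where
  "d1 f = (\<lambda>x y. if x \<in> L \<and> y \<in> L then br x (f y) - br y (f x) - f (br x y) else 0)"

definition d2 :: "('v \<Rightarrow> 'v \<Rightarrow> 'v) \<Rightarrow> 'v \<Rightarrow> 'v \<Rightarrow> 'v \<Rightarrow> 'v" where
  "d2 c = (\<lambda>x y z. if x \<in> L \<and> y \<in> L \<and> z \<in> L
     then br x (c y z) - br y (c x z) + br z (c x y)
        - c (br x y) z + c (br x z) y - c (br y z) x
     else 0)"

definition Z2 :: "('v \<Rightarrow> 'v \<Rightarrow> 'v) set" where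
  "Z2 = {c \<in> C2. d2 c = 0}"

definition B2 :: "('v \<Rightarrow> 'v \<Rightarrow> 'v) set" where
  "B2 = d1 ` C1"

text \<open>
  The elements of \<open>H2\<close> are the cosets of \<open>B2\<close> in \<open>Z2\<close>. Addition of cosets is the addition of sets
  from the library theory of set algebras. Scalar multiplication adds \<open>B2\<close> explicitly, because
  multiplying every representative by the scalar 0 would only leave \<open>{0}\<close>.
\<close>

definition cohomology_class :: "('v \<Rightarrow> 'v \<Rightarrow> 'v) \<Rightarrow> ('v \<Rightarrow> 'v \<Rightarrow> 'v) set" where
  "cohomology_class c = c +o B2"

definition H2 :: "('v \<Rightarrow> 'v \<Rightarrow> 'v) set set" where
  "H2 = cohomology_class ` Z2"

definition class_scale ::
    "'k \<Rightarrow> ('v \<Rightarrow> 'v \<Rightarrow> 'v) set \<Rightarrow> ('v \<Rightarrow> 'v \<Rightarrow> 'v) set" where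
  "class_scale r A = (\<lambda>c x y. r *s c x y) ` A + B2"

inductive_set H2_span :: "('v \<Rightarrow> 'v \<Rightarrow> 'v) set set \<Rightarrow> ('v \<Rightarrow> 'v \<Rightarrow> 'v) set set"
  for S where
  zero: "B2 \<in> H2_span S"
| base: "A \<in> S \<Longrightarrow> A \<in> H2_span S"
| add: "A \<in> H2_span S \<Longrightarrow> B \<in> H2_span S \<Longrightarrow> A + B \<in> H2_span S"
| scale: "A \<in> H2_span S \<Longrightarrow> class_scale r A \<in> H2_span S"

lemma derived_subset: "derived \<subseteq> L"
  unfolding derived_def by (rule span_minimal) (auto simp: br_closed subspace_L)

lemma lie_algebra_derived: "lie_algebra (*s) derived br"
proof (unfold_locales, goal_cases)
  case 1
  show ?case unfolding derived_def by (rule subspace_span)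
next
  case (2 x y)
  then show ?case
    using derived_subset unfolding derived_def by (intro span_base) blast
qed (use derived_subset in
      \<open>simp_all add: subset_iff br_add_left br_add_right br_scale_left br_scale_right br_self jacobi\<close>)

end


section \<open>The Lie algebras of matrices preserving the form with Gram matrix the identity\<close>

definition mscale :: "'k::field \<Rightarrow> 'k^'n^'m \<Rightarrow> 'k^'n^'m" where
  "mscale r A = (\<chi> i j. r * A $ i $ j)"

global_interpretation mtx: vector_space mscale
  by unfold_locales (simp_all add: mscale_def vec_eq_iff algebra_simps)

definition commutator :: "'k::field^'n^'n \<Rightarrow> 'k^'n^'n \<Rightarrow> 'k^'n^'n" where
  "commutator A B = A ** B - B ** A"

text \<open>\<open>X\<close> preserves the form infinitesimally: \<open>B (X v) w + B v (X w) = 0\<close> for all \<open>v\<close>, \<open>w\<close>.\<close>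

definition form_algebra :: "'k::field^'n^'n \<Rightarrow> ('k^'n^'n) set" where
  "form_algebra B = {X. transpose X ** B + B ** X = 0}"

definition o_I :: "('k::field^'n^'n) set" where
  "o_I = form_algebra (mat 1)"

lemma commutator_linear:
  "commutator (x + y) z = commutator x z + commutator y z"
  "commutator x (y + z) = commutator x y + commutator x z"
  "commutator (mscale r x) y = mscale r (commutator x y)"
  "commutator x (mscale r y) = mscale r (commutator x y)"
  by (simp_all add: commutator_def mscale_def vec_eq_iff matrix_matrix_mult_def algebra_simps
      sum.distrib sum_distrib_left)

lemma commutator_jacobi:
  fixes x y z :: "'k::field^'n^'n"
  shows   "commutator x (commutator y z) + commutator y (commutator z x) + commutator z (commutator x y) = 0"
proof -
  have diff: "a ** (b - c) = a ** b - a ** c" "(a - b) ** c = a ** c - b ** c"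
    for a b c :: "'k^'n^'n"
    by (simp_all add: matrix_matrix_mult_def vec_eq_iff algebra_simps sum_subtractf)
  show ?thesis
    by (simp add: commutator_def diff matrix_mul_assoc)
qed

lemma o_I_iff: "X \<in> o_I \<longleftrightarrow> (\<forall>i j. X $ j $ i = - (X $ i $ j))"
  by (simp add: o_I_def form_algebra_def vec_eq_iff transpose_def add_eq_0_iff2)

global_interpretation oI: lie_algebra mscale o_I commutator
proof (unfold_locales, goal_cases)
  case 1
  show ?case
  proof (rule mtx.subspaceI)
    fix x y :: "'a^'b^'b" and r
    assume x: "x \<in> o_I"
    show "mscale r x \<in> o_I"
      unfolding o_I_iff mscale_def vec_lambda_beta
      using x[unfolded o_I_iff] by (metis mult_minus_right)
    assume y: "y \<in> o_I"
    show "x + y \<in> o_I"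
      unfolding o_I_iff vector_add_component minus_add_distrib
      using x[unfolded o_I_iff] y[unfolded o_I_iff] by metis
  qed (simp add: o_I_iff)
next
  case (2 x y)
  then have *: "x $ j $ i = - (x $ i $ j)" "y $ j $ i = - (y $ i $ j)" for i j
    unfolding o_I_iff by blast+
  have "x $ j $ k * y $ k $ i = y $ i $ k * x $ k $ j" "y $ j $ k * x $ k $ i = x $ i $ k * y $ k $ j"
    for i j k
    by (simp_all only: *[of j k] *[of k i] mult.commute minus_mult_minus)
  then show ?case
    by (simp add: o_I_iff commutator_def matrix_matrix_mult_def)
qed (simp_all add: commutator_linear commutator_jacobi, simp add: commutator_def)

definition o_I1 :: "('k::field^'n^'n) set" where
  "o_I1 = oI.derived"

global_interpretation oI1: lie_algebra mscale o_I1 commutator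
  unfolding o_I1_def by (rule oI.lie_algebra_derived)


section \<open>The basis of the derived algebra for 4 x 4 matrices and its dual\<close>

definition E_unit :: "'n \<Rightarrow> 'n \<Rightarrow> 'k::field^'n^'n" where
  "E_unit i j = (\<chi> a b. if a = i \<and> b = j then 1 else 0)"

definition F :: "'n \<Rightarrow> 'n \<Rightarrow> 'k::field^'n^'n" where
  "F i j = E_unit i j + E_unit j i"

text \<open>
  The index type \<open>4\<close> has exactly the elements 1, 2, 3, 4, but 4 = 0 there and is the least element,
  so the pairs \<open>i < j\<close> are listed explicitly.
\<close>

definition F_basis :: "('k::field^4^4) set" where
  "F_basis = {F 1 2, F 1 3, F 1 4, F 2 3, F 2 4, F 3 4}"

text \<open>The functional \<open>F_hat i j\<close> is extended by 0 outside the span of the basis.\<close>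

definition F_hat :: "4 \<Rightarrow> 4 \<Rightarrow> 'k::field^4^4 \<Rightarrow> 'k" where
  "F_hat i j X = mtx.representation F_basis X (F i j)"

lemma F_nth: "F i j $ a $ b = (if a = i \<and> b = j then 1 else 0) + (if a = j \<and> b = i then 1 else 0)"
  by (simp add: F_def E_unit_def)

lemma F_distinct: "i \<noteq> j \<Longrightarrow> F i j = (F k l :: 'k::field^'n^'n) \<longleftrightarrow> (i = k \<and> j = l \<or> i = l \<and> j = k)" 
proof
  assume "i \<noteq> j" "F i j = (F k l :: 'k^'n^'n)"
  then have "F i j $ i $ j = (F k l $ i $ j :: 'k)" by simp
  then show "i = k \<and> j = l \<or> i = l \<and> j = k" using \<open>i \<noteq> j\<close>
    by (auto simp: F_nth split: if_splits)
qed (auto simp: F_def add.commute)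

lemma sum_F_basis:
  "(\<Sum>b\<in>F_basis. f b) = f (F 1 2) + f (F 1 3) + f (F 1 4) + f (F 2 3) + f (F 2 4) + f (F 3 4 :: 'k::field^4^4)"
  by (simp add: F_basis_def F_distinct add.assoc)

lemma independent_F_basis: "mtx.independent (F_basis :: ('k::field^4^4) set)"
proof
  assume "mtx.dependent (F_basis :: ('k::field^4^4) set)"
  then obtain u where u: "\<exists>v\<in>F_basis. u v \<noteq> 0" 
    and z: "(\<Sum>v\<in>F_basis. mscale (u v) v) = (0 :: 'k^4^4)"
    by (subst (asm) mtx.dependent_finite) (auto simp: F_basis_def)
  have "(\<Sum>v\<in>F_basis. mscale (u v) v) $ i $ j = (0 :: 'k)" for i j by (simp add: z)
  from this[of 1 2] this[of 1 3] this[of 1 4] this[of 2 3] this[of 2 4] this[of 3 4] u show False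
    by (simp add: sum_F_basis mscale_def F_nth) (simp add: F_basis_def)
qed

lemma F_basis_expansion:
  assumes "\<And>i j. X $ i $ j = X $ j $ i" "\<And>i. X $ i $ i = 0"
  shows "(X :: 'k::field^4^4) = mscale (X$1$2) (F 1 2) + mscale (X$1$3) (F 1 3) + mscale (X$1$4) (F 1 4)
     + mscale (X$2$3) (F 2 3) + mscale (X$2$4) (F 2 4) + mscale (X$3$4) (F 3 4)"
  using assms(1)[of 2 1] assms(1)[of 3 1] assms(1)[of 4 1] assms(1)[of 3 2] assms(1)[of 4 2] assms(1)[of 4 3]
  by (simp add: vec_eq_iff mscale_def F_nth forall_4 assms(2))

lemma
  assumes c: "CHAR('k::field) = 2"
  shows o_I1_eq: "(o_I1 :: ('k^4^4) set) = {X. (\<forall>i j. X $ i $ j = X $ j $ i) \<and> (\<forall>i. X $ i $ i = 0)}" (is "_ = ?R")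
    and span_F_basis: "mtx.span (F_basis :: ('k^4^4) set) = o_I1"
proof -
  have m: "- x = x" for x :: 'k using c by (rule uminus_CHAR_2)
  have sub: "mtx.subspace ?R"
    by (rule mtx.subspaceI) (auto simp: mscale_def)
  have 1: "o_I1 \<subseteq> ?R"
    unfolding o_I1_def oI.derived_def
  proof (rule mtx.span_minimal[OF _ sub], clarify)
    fix x y :: "'k^4^4" assume xy: "x \<in> o_I" "y \<in> o_I"
    have "commutator x y \<in> o_I" by (rule oI.br_closed[OF xy])
    moreover have "x $ i $ k = x $ k $ i" "y $ i $ k = y $ k $ i" for i k
      using xy unfolding o_I_iff m by blast+
    then have "commutator x y $ i $ i = 0" for i
      by (auto simp: commutator_def matrix_matrix_mult_def mult.commute intro!: sum.cong)
    ultimately show "(\<forall>i j. commutator x y $ i $ j = commutator x y $ j $ i) \<and> (\<forall>i. commutator x y $ i $ i = 0)"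
      unfolding o_I_iff m by blast
  qed
  have 2: "?R \<subseteq> mtx.span F_basis"
  proof clarify
    fix X :: "'k^4^4" assume "\<forall>i j. X $ i $ j = X $ j $ i" "\<forall>i. X $ i $ i = 0"
    then have X: "X = mscale (X$1$2) (F 1 2) + mscale (X$1$3) (F 1 3) + mscale (X$1$4) (F 1 4)
     + mscale (X$2$3) (F 2 3) + mscale (X$2$4) (F 2 4) + mscale (X$3$4) (F 3 4)"
      by (intro F_basis_expansion) auto
    show "X \<in> mtx.span F_basis"
      by (subst X) (intro mtx.span_add mtx.span_scale mtx.span_base; simp add: F_basis_def)
  qed
  have F: "F i j \<in> (o_I :: ('k^4^4) set)" for i j
    unfolding o_I_iff m F_nth by (simp add: add.commute conj_commute)
  have "F i j = commutator (F i k) (F k j :: 'k^4^4)" if "i \<noteq> j" "i \<noteq> k" "k \<noteq> j" for i j k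
    using that by (auto simp: commutator_def matrix_matrix_mult_def vec_eq_iff F_nth distrib_left distrib_right sum.distrib m if_distrib[of "\<lambda>x. x * _"] cong: if_cong)
  then have "F i j \<in> (o_I1 :: ('k^4^4) set)" if "i \<noteq> j" "i \<noteq> k" "k \<noteq> j" for i j k
    unfolding o_I1_def oI.derived_def using F that by (intro mtx.span_base) blast
  from this[of 1 2 3] this[of 1 3 2] this[of 1 4 2] this[of 2 3 1] this[of 2 4 1] this[of 3 4 1]
  have 3: "mtx.span F_basis \<subseteq> (o_I1 :: ('k^4^4) set)"
    by (intro mtx.span_minimal oI1.subspace_L) (simp add: F_basis_def)
  show "o_I1 = ?R" "mtx.span (F_basis :: ('k^4^4) set) = o_I1" using 1 2 3 by blast+
qed

lemma F_hat_eq: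
  assumes "CHAR('k::field) = 2" "X \<in> (o_I1 :: ('k^4^4) set)"
  shows "F_hat 1 2 X = X$1$2" "F_hat 1 3 X = X$1$3" "F_hat 1 4 X = X$1$4"
    "F_hat 2 3 X = X$2$3" "F_hat 2 4 X = X$2$4" "F_hat 3 4 X = X$3$4"
proof -
  have *: "(\<Sum>b\<in>F_basis. mscale (mtx.representation F_basis X b) b) = X"
    by (rule mtx.sum_representation_eq)
      (simp_all add: independent_F_basis span_F_basis[OF assms(1)] assms(2), simp add: F_basis_def)
  have "F_hat 1 2 X = (\<Sum>b\<in>F_basis. mscale (mtx.representation F_basis X b) b)$1$2"
   "F_hat 1 3 X = (\<Sum>b\<in>F_basis. mscale (mtx.representation F_basis X b) b)$1$3"
   "F_hat 1 4 X = (\<Sum>b\<in>F_basis. mscale (mtx.representation F_basis X b) b)$1$4"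
   "F_hat 2 3 X = (\<Sum>b\<in>F_basis. mscale (mtx.representation F_basis X b) b)$2$3"
   "F_hat 2 4 X = (\<Sum>b\<in>F_basis. mscale (mtx.representation F_basis X b) b)$2$4"
   "F_hat 3 4 X = (\<Sum>b\<in>F_basis. mscale (mtx.representation F_basis X b) b)$3$4"
    by (simp_all only: sum_F_basis) (simp_all add: F_hat_def mscale_def F_nth)
  then show "F_hat 1 2 X = X$1$2" "F_hat 1 3 X = X$1$3" "F_hat 1 4 X = X$1$4"
    "F_hat 2 3 X = X$2$3" "F_hat 2 4 X = X$2$4" "F_hat 3 4 X = X$3$4" by (simp_all only: *)
qed

text \<open>The cochain \<open>u \<otimes> v \<and> w\<close>; in characteristic 2 the sum is the usual wedge product.\<close>

definition tensor_wedge ::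
    "'k::field^4^4 \<Rightarrow> ('k^4^4 \<Rightarrow> 'k) \<Rightarrow> ('k^4^4 \<Rightarrow> 'k) \<Rightarrow> 'k^4^4 \<Rightarrow> 'k^4^4 \<Rightarrow> 'k^4^4" where
  "tensor_wedge u v w = (\<lambda>X Y. mscale (v X * w Y + v Y * w X) u)"

definition c1 :: "'k::field^4^4 \<Rightarrow> 'k^4^4 \<Rightarrow> 'k^4^4" where
  "c1 = tensor_wedge (F 1 3) (F_hat 1 2) (F_hat 2 3)
      + tensor_wedge (F 1 4) (F_hat 1 2) (F_hat 2 4)
      + tensor_wedge (F 3 4) (F_hat 2 3) (F_hat 2 4)"

definition c2 :: "'k::field^4^4 \<Rightarrow> 'k^4^4 \<Rightarrow> 'k^4^4" where
  "c2 = tensor_wedge (F 1 3) (F_hat 2 3) (F_hat 3 4)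
      + tensor_wedge (F 2 3) (F_hat 1 3) (F_hat 3 4)
      + tensor_wedge (F 3 4) (F_hat 1 3) (F_hat 2 3)"

definition c3 :: "'k::field^4^4 \<Rightarrow> 'k^4^4 \<Rightarrow> 'k^4^4" where
  "c3 = tensor_wedge (F 1 2) (F_hat 1 3) (F_hat 2 3)
      + tensor_wedge (F 1 4) (F_hat 1 3) (F_hat 3 4)
      + tensor_wedge (F 2 4) (F_hat 2 3) (F_hat 3 4)"

definition c4 :: "'k::field^4^4 \<Rightarrow> 'k^4^4 \<Rightarrow> 'k^4^4" where
  "c4 = tensor_wedge (F 1 2) (F_hat 2 3) (F_hat 2 4)
      + tensor_wedge (F 2 3) (F_hat 1 2) (F_hat 2 4)
      + tensor_wedge (F 2 4) (F_hat 1 2) (F_hat 2 3)"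

definition c5 :: "'k::field^4^4 \<Rightarrow> 'k^4^4 \<Rightarrow> 'k^4^4" where
  "c5 = tensor_wedge (F 1 2) (F_hat 1 3) (F_hat 1 4)
      + tensor_wedge (F 1 3) (F_hat 1 2) (F_hat 1 4)
      + tensor_wedge (F 1 4) (F_hat 1 2) (F_hat 1 3)"

definition c6 :: "'k::field^4^4 \<Rightarrow> 'k^4^4 \<Rightarrow> 'k^4^4" where
  "c6 = tensor_wedge (F 1 2) (F_hat 1 4) (F_hat 2 4)
      + tensor_wedge (F 1 3) (F_hat 1 4) (F_hat 3 4)
      + tensor_wedge (F 2 3) (F_hat 2 4) (F_hat 3 4)"

end

theory Submission
  imports Defs
begin

text \<open>
  Write \<open>\<gg>\<close> for the Lie algebra of symmetric matrices with zero diagonal. In characteristic 2 its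
  bracket is \<open>[F i j, F j k] = F i k\<close>, and \<open>F i j\<close>, \<open>F k l\<close> commute when the index pairs are
  disjoint.

  \<^emph>\<open>The cochains are cocycles.\<close> For every matrix \<open>D\<close> the product \<open>X D Y\<close> is associative, and
  for symmetric \<open>D\<close> its commutator preserves \<open>\<gg>\<close>; so \<open>X (1 + t D) Y - Y (1 + t D) X\<close> is a Lie bracket
  on \<open>\<gg>\<close> for every \<open>t\<close>. Its coefficient \<open>X D Y - Y D X\<close> at \<open>t\<close> is therefore a cocycle
  (\<open>twisted_bracket_Z2\<close>); for the diagonal matrix units 2, 3, 4 it is \<open>c1\<close>, \<open>c3\<close>, \<open>c6\<close>. The linear map exchanging \<open>F i j\<close> with the \<open>F k l\<close> of the
  complementary pair commutes with all \<open>ad X\<close> (\<open>hodge_centroid\<close>), so composing with it preserves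
  cocycles (\<open>centroid_compose_Z2\<close>); from the diagonal matrix units 1, 2, 3 this gives \<open>c5\<close>, \<open>c4\<close>, \<open>c2\<close>.

  \<^emph>\<open>They span.\<close> \<open>\<gg>\<close> is generated by \<open>F 1 2\<close>, \<open>F 2 3\<close>, \<open>F 3 4\<close>: the other basis vectors are
  \<open>F 1 3 = [F 1 2, F 2 3]\<close>, \<open>F 2 4 = [F 2 3, F 3 4]\<close>, \<open>F 1 4 = [F 1 2, F 2 4]\<close>. The values of a
  1-cochain on these three vectors can be chosen so that its coboundary cancels a given cocycle on
  the three defining pairs (\<open>exists_normalizing_coboundary\<close>). Call a cocycle normalized if it
  vanishes on them. Consider further the five pairs
  \<open>(F 1 2, F 3 4)\<close>, \<open>(F 1 2, F 1 3)\<close>, \<open>(F 1 3, F 2 3)\<close>, \<open>(F 2 3, F 2 4)\<close>, \<open>(F 2 4, F 3 4)\<close>, whose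
  brackets are relations between the generators. A normalized cocycle that vanishes on them is zero
  (\<open>cocycle_eq_0_if_relations\<close>), and the five values of any normalized cocycle are given by
  twelve scalars (\<open>normalized_cocycle_relations\<close>). Six of the scalars are removed by the coboundary
  of a 1-cochain prescribed on the generators, and the remaining six by a combination of
  \<open>c1\<close>, \<dots>, \<open>c6\<close> (\<open>cocycle_cohomologous_to_combination\<close>).
\<close>

section \<open>Cocycles, coboundaries and classes in an arbitrary Lie algebra\<close>

context lie_algebra
begin

lemma br_zero [simp]:
  assumes "x \<in> L"
  shows "br 0 x = 0" "br x 0 = 0"
  using br_scale_left[of x x 0] br_scale_right[of x x 0] assms by simp_all

lemma br_anticommute:
  assumes "x \<in> L" "y \<in> L"
  shows "br y x = - br x y"
proof -
  have sum: "x + y \<in> L" using assms by (rule subspace_add[OF subspace_L])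
  have "br (x + y) (x + y) = br x y + br y x"
    by (subst br_add_left[OF assms sum]) (simp add: br_add_right br_self assms)
  then show ?thesis
    using br_self[OF sum] by (simp add: add_eq_0_iff)
qed

lemma br_diff_right: "x \<in> L \<Longrightarrow> y \<in> L \<Longrightarrow> z \<in> L \<Longrightarrow> br x (y - z) = br x y - br x z"
  using br_add_right[of x "y - z" z] subspace_diff[OF subspace_L, of y z] by simp

lemma br_minus_right: "x \<in> L \<Longrightarrow> y \<in> L \<Longrightarrow> br x (- y) = - br x y"
  using br_scale_right[of x y "-1"] by simp

lemma br_derivation:
  assumes "x \<in> L" "y \<in> L" "z \<in> L"
  shows "br (br x y) z = br x (br y z) - br y (br x z)"
proof -
  have "br y (br z x) = - br y (br x z)"
    using br_anticommute[of x z] br_scale_right[of y "br x z" "-1"] assms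
    by (simp add: br_closed)
  moreover have "br z (br x y) = - br (br x y) z"
    using br_anticommute[of "br x y" z] assms by (simp add: br_closed)
  ultimately show ?thesis
    using jacobi[OF assms] by (simp add: algebra_simps)
qed

lemma C1_D:
  assumes "f \<in> C1"
  shows "x \<in> L \<Longrightarrow> f x \<in> L"
    and "x \<in> L \<Longrightarrow> y \<in> L \<Longrightarrow> f (x + y) = f x + f y"
    and "x \<in> L \<Longrightarrow> f (scale r x) = scale r (f x)"
    and "x \<in> L \<Longrightarrow> y \<in> L \<Longrightarrow> f (x - y) = f x - f y"
proof -
  show *: "x \<in> L \<Longrightarrow> f x \<in> L"
    "x \<in> L \<Longrightarrow> y \<in> L \<Longrightarrow> f (x + y) = f x + f y"
    "x \<in> L \<Longrightarrow> f (scale r x) = scale r (f x)" for x y r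
    using assms by (auto simp: C1_def linear_on_L_def)
  show "x \<in> L \<Longrightarrow> y \<in> L \<Longrightarrow> f (x - y) = f x - f y"
    using *(2)[of "x - y" y] subspace_diff[OF subspace_L, of x y] by simp
qed

lemma C2_D:
  assumes "c \<in> C2"
  shows "x \<in> L \<Longrightarrow> y \<in> L \<Longrightarrow> c x y \<in> L"
    and "x \<in> L \<Longrightarrow> y \<in> L \<Longrightarrow> z \<in> L \<Longrightarrow> c (x + y) z = c x z + c y z"
    and "x \<in> L \<Longrightarrow> y \<in> L \<Longrightarrow> z \<in> L \<Longrightarrow> c z (x + y) = c z x + c z y"
    and "x \<in> L \<Longrightarrow> y \<in> L \<Longrightarrow> c (scale r x) y = scale r (c x y)"
    and "x \<in> L \<Longrightarrow> y \<in> L \<Longrightarrow> c x (scale r y) = scale r (c x y)"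
    and "x \<in> L \<Longrightarrow> c x x = 0"
    and "x \<notin> L \<Longrightarrow> c x y = 0"
    and "y \<notin> L \<Longrightarrow> c x y = 0"
  using assms by (auto simp: C2_def linear_on_L_def)

lemma C2_I:
  assumes "\<And>x y. x \<in> L \<Longrightarrow> y \<in> L \<Longrightarrow> c x y \<in> L"
    and "\<And>x y z. x \<in> L \<Longrightarrow> y \<in> L \<Longrightarrow> z \<in> L \<Longrightarrow> c (x + y) z = c x z + c y z"
    and "\<And>x y z. x \<in> L \<Longrightarrow> y \<in> L \<Longrightarrow> z \<in> L \<Longrightarrow> c z (x + y) = c z x + c z y"
    and "\<And>r x y. x \<in> L \<Longrightarrow> y \<in> L \<Longrightarrow> c (scale r x) y = scale r (c x y)"
    and "\<And>r x y. x \<in> L \<Longrightarrow> y \<in> L \<Longrightarrow> c x (scale r y) = scale r (c x y)"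
    and "\<And>x. x \<in> L \<Longrightarrow> c x x = 0"
    and "\<And>x y. x \<notin> L \<or> y \<notin> L \<Longrightarrow> c x y = 0"
  shows "c \<in> C2"
  using assms by (auto simp: C2_def linear_on_L_def)

lemma C2_zero [simp]:
  assumes "c \<in> C2" "x \<in> L"
  shows "c 0 x = 0" "c x 0 = 0"
  using C2_D(4)[OF assms(1), of x x 0] C2_D(5)[OF assms(1), of x x 0] assms(2) by simp_all

lemma C2_anticommute:
  assumes "c \<in> C2" "x \<in> L" "y \<in> L"
  shows "c y x = - c x y"
proof -
  have sum: "x + y \<in> L" using assms by (intro subspace_add[OF subspace_L])
  have "c (x + y) (x + y) = c x y + c y x"
    by (subst C2_D(2)[OF assms sum]) (simp add: C2_D(3,6) assms)
  then show ?thesis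
    using C2_D(6)[OF assms(1) sum] by (simp add: add_eq_0_iff)
qed

lemma C2_add:
  assumes "c \<in> C2" "c' \<in> C2"
  shows "c + c' \<in> C2"
  by (rule C2_I)
    (auto simp: C2_D[OF assms(1)] C2_D[OF assms(2)] subspace_add[OF subspace_L]
      scale_right_distrib)

lemma C2_scale:
  assumes "c \<in> C2"
  shows "(\<lambda>x y. scale r (c x y)) \<in> C2"
  by (rule C2_I)
    (auto simp: C2_D[OF assms] subspace_scale[OF subspace_L] scale_right_distrib mult.commute)

lemma Z2_add:
  assumes "c \<in> Z2" "c' \<in> Z2"
  shows "c + c' \<in> Z2"
proof -
  have C2: "c \<in> C2" "c' \<in> C2" and 0: "d2 c = 0" "d2 c' = 0"
    using assms by (auto simp: Z2_def)
  have "d2 (c + c') = d2 c + d2 c'"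
    by (intro ext) (simp add: d2_def C2_D(1)[OF C2(1)] C2_D(1)[OF C2(2)] br_add_right)
  then show ?thesis
    using C2 0 by (simp add: Z2_def C2_add)
qed

lemma Z2_scale:
  assumes "c \<in> Z2"
  shows "(\<lambda>x y. scale r (c x y)) \<in> Z2"
proof -
  have C2: "c \<in> C2" and 0: "d2 c = 0"
    using assms by (auto simp: Z2_def)
  have "d2 (\<lambda>x y. scale r (c x y)) = (\<lambda>x y z. scale r (d2 c x y z))"
    by (intro ext)
      (simp add: d2_def C2_D(1)[OF C2] br_scale_right scale_right_distrib scale_right_diff_distrib)
  then show ?thesis
    using C2 0 by (simp add: Z2_def C2_scale fun_eq_iff)
qed

lemma d1_in_C2:
  assumes f: "f \<in> C1"
  shows "d1 f \<in> C2"
proof (rule C2_I, goal_cases)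
  case (1 x y)
  then show ?case
    by (simp add: d1_def C1_D[OF f] br_closed subspace_diff[OF subspace_L])
next
  case (6 x)
  then show ?case
    using C1_D(3)[OF f, of x 0] by (simp add: d1_def br_self)
next
  case (7 x y)
  then show ?case by (auto simp: d1_def)
qed (simp_all add: d1_def C1_D[OF f] subspace_add[OF subspace_L] subspace_scale[OF subspace_L]
    br_closed br_add_left br_add_right br_scale_left br_scale_right scale_right_diff_distrib)

text \<open>
  In \<open>d2 (d1 f)\<close> the terms with \<open>f\<close> innermost cancel because \<open>ad\<close> is a representation, the terms
  with \<open>f\<close> outermost because of the Jacobi identity, and those with \<open>f\<close> in the middle cancel in pairs.
\<close>

lemma d1_in_Z2:
  assumes f: "f \<in> C1"
  shows "d1 f \<in> Z2"
proof -
  have "d2 (d1 f) x y z = 0" if L: "x \<in> L" "y \<in> L" "z \<in> L" for x y z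
  proof -
    have derivation: "br (br a b) (f d) = br a (br b (f d)) - br b (br a (f d))"
      if "a \<in> L" "b \<in> L" "d \<in> L" for a b d
      using that by (simp add: br_derivation C1_D(1)[OF f])
    have "br x (br y z) = - br (br y z) x" "br z (br x y) = - br (br x y) z"
      using L by (simp_all add: br_anticommute[of _ "br _ _"] br_closed)
    moreover have "br y (br z x) = br (br x z) y"
      using L by (simp add: br_anticommute[of x z] br_anticommute[of "br x z" y] br_minus_right br_closed)
    ultimately have "br (br x y) z - br (br x z) y + br (br y z) x = 0"
      using jacobi[OF L] by (simp add: algebra_simps)
    then have "f (br (br x y) z - br (br x z) y + br (br y z) x) = 0"
      using C1_D(3)[OF f, of 0 0] subspace_0[OF subspace_L] by simp
    then have "f (br (br x y) z) - f (br (br x z) y) + f (br (br y z) x) = 0"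
      using L by (simp add: C1_D[OF f] br_closed subspace_diff[OF subspace_L])
    then show ?thesis
      using L by (simp add: d2_def d1_def C1_D[OF f] br_closed br_diff_right br_add_right derivation
          subspace_diff[OF subspace_L] subspace_add[OF subspace_L] algebra_simps)
  qed
  then show ?thesis
    using f by (simp add: Z2_def d1_in_C2 fun_eq_iff) (simp add: d2_def)
qed

lemma d1_add: "f \<in> C1 \<Longrightarrow> g \<in> C1 \<Longrightarrow> d1 f + d1 g = d1 (f + g)"
  by (intro ext) (simp add: d1_def C1_D br_add_right br_closed)

lemma C1_add: "f \<in> C1 \<Longrightarrow> g \<in> C1 \<Longrightarrow> f + g \<in> C1"
  by (auto simp: C1_def linear_on_L_def scale_right_distrib subspace_add[OF subspace_L])

lemma C1_scale: "f \<in> C1 \<Longrightarrow> (\<lambda>x. scale r (f x)) \<in> C1"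
  by (auto simp: C1_def linear_on_L_def scale_right_distrib subspace_scale[OF subspace_L] mult.commute)

lemma B2_add: "b \<in> B2 \<Longrightarrow> b' \<in> B2 \<Longrightarrow> b + b' \<in> B2"
  unfolding B2_def by (auto simp: d1_add intro!: imageI C1_add)

lemma B2_scale:
  assumes "b \<in> B2"
  shows "(\<lambda>x y. scale r (b x y)) \<in> B2"
proof -
  obtain f where f: "f \<in> C1" "b = d1 f"
    using assms by (auto simp: B2_def)
  then have "(\<lambda>x y. scale r (b x y)) = d1 (\<lambda>x. scale r (f x))"
    by (intro ext) (simp add: d1_def C1_D br_scale_right scale_right_diff_distrib)
  then show ?thesis
    using C1_scale[OF f(1)] by (auto simp: B2_def)
qed

lemma B2_zero: "0 \<in> B2"
proof -
  have "(\<lambda>x. 0) \<in> C1" "d1 (\<lambda>x. 0) = 0"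
    using subspace_0[OF subspace_L] by (auto simp: C1_def linear_on_L_def d1_def fun_eq_iff)
  then show ?thesis by (force simp: B2_def)
qed

lemma B2_subset_Z2: "B2 \<subseteq> Z2"
  by (auto simp: B2_def d1_in_Z2)

lemma B2_uminus: "b \<in> B2 \<Longrightarrow> - b \<in> B2"
  using B2_scale[of b "-1"] by (simp add: fun_Compl_def)

lemma B2_plus_B2: "B2 + B2 = B2"
proof
  show "B2 + B2 \<subseteq> B2"
    using B2_add by (auto simp: set_plus_def)
  show "B2 \<subseteq> B2 + B2"
    using set_plus_intro[OF _ B2_zero] by (metis add.right_neutral subsetI)
qed

lemma cohomology_class_zero: "cohomology_class 0 = B2"
  by (auto simp: cohomology_class_def elt_set_plus_def)

lemma cohomology_class_add: "cohomology_class c + cohomology_class c' = cohomology_class (c + c')"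
  by (simp add: cohomology_class_def set_plus_rearrange B2_plus_B2)

lemma cohomology_class_add_coboundary:
  assumes "b \<in> B2"
  shows "cohomology_class (c + b) = cohomology_class c"
proof -
  have "b +o B2 = B2"
  proof
    show "b +o B2 \<subseteq> B2" using B2_add assms by (auto simp: elt_set_plus_def)
    show "B2 \<subseteq> b +o B2"
    proof
      fix x assume "x \<in> B2"
      then have "x + - b \<in> B2" "x = b + (x + - b)"
        using B2_add[of x "- b"] B2_uminus assms by simp_all
      then show "x \<in> b +o B2" unfolding elt_set_plus_def by blast
    qed
  qed
  then show ?thesis
    by (simp add: cohomology_class_def set_plus_rearrange2[symmetric])
qed

text \<open>
  The summand \<open>B2\<close> in \<open>class_scale\<close> makes this hold for \<open>r = 0\<close> as well.
\<close>

lemma class_scale_cohomology_class: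
  "class_scale r (cohomology_class c) = cohomology_class (\<lambda>x y. scale r (c x y))"
proof -
  have *: "(\<lambda>x y. scale r ((c + b) x y)) = (\<lambda>x y. scale r (c x y)) + (\<lambda>x y. scale r (b x y))" for b
    by (simp add: fun_eq_iff scale_right_distrib)
  show ?thesis
  proof
    show "class_scale r (cohomology_class c) \<subseteq> cohomology_class (\<lambda>x y. scale r (c x y))"
    proof
      fix z assume "z \<in> class_scale r (cohomology_class c)"
      then obtain b b' where "b \<in> B2" "b' \<in> B2" "z = (\<lambda>x y. scale r ((c + b) x y)) + b'"
        by (auto simp: class_scale_def cohomology_class_def elt_set_plus_def set_plus_def)
      then have "z = (\<lambda>x y. scale r (c x y)) + ((\<lambda>x y. scale r (b x y)) + b')"
        "(\<lambda>x y. scale r (b x y)) + b' \<in> B2"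
        by (simp_all only: * add.assoc B2_add B2_scale)
      then show "z \<in> cohomology_class (\<lambda>x y. scale r (c x y))"
        unfolding cohomology_class_def elt_set_plus_def by blast
    qed
    show "cohomology_class (\<lambda>x y. scale r (c x y)) \<subseteq> class_scale r (cohomology_class c)"
    proof
      fix z assume "z \<in> cohomology_class (\<lambda>x y. scale r (c x y))"
      then obtain b where b: "b \<in> B2" "z = (\<lambda>x y. scale r (c x y)) + b"
        by (auto simp: cohomology_class_def elt_set_plus_def)
      have "c \<in> cohomology_class c"
        using B2_zero by (force simp: cohomology_class_def elt_set_plus_def)
      then show "z \<in> class_scale r (cohomology_class c)"
        unfolding class_scale_def b(2) using b(1) by (intro set_plus_intro imageI)
    qed
  qed
qed

lemma H2_span_subset_H2:
  assumes "S \<subseteq> Z2"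
  shows "H2_span (cohomology_class ` S) \<subseteq> H2"
proof
  fix A assume "A \<in> H2_span (cohomology_class ` S)"
  then show "A \<in> H2"
  proof induction
    case zero
    have "0 \<in> Z2" using B2_zero B2_subset_Z2 by blast
    then show ?case unfolding H2_def cohomology_class_zero[symmetric] by blast
  next
    case (base A)
    then show ?case using assms by (auto simp: H2_def)
  next
    case (add A B)
    then show ?case by (auto simp: H2_def cohomology_class_add intro!: imageI Z2_add)
  next
    case (scale A r)
    then show ?case by (auto simp: H2_def class_scale_cohomology_class intro!: imageI Z2_scale)
  qed
qed

lemma class_add_in_H2_span:
  assumes "cohomology_class c \<in> H2_span S" "cohomology_class c' \<in> H2_span S"
  shows "cohomology_class (c + c') \<in> H2_span S"
  using H2_span.add[OF assms] by (simp add: cohomology_class_add)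

lemma class_scale_in_H2_span:
  assumes "cohomology_class c \<in> H2_span S"
  shows "cohomology_class (\<lambda>x y. scale r (c x y)) \<in> H2_span S"
  using H2_span.scale[OF assms] by (simp add: class_scale_cohomology_class)

text \<open>
  A linear map \<open>T\<close> that commutes with every \<open>ad x\<close> is an endomorphism of the adjoint module, and
  cohomology is functorial in the coefficient module.
\<close>

lemma centroid_compose_Z2:
  assumes T: "T \<in> C1" and comm: "\<And>x y. x \<in> L \<Longrightarrow> y \<in> L \<Longrightarrow> br x (T y) = T (br x y)"
    and c: "c \<in> Z2"
  shows "(\<lambda>x y. T (c x y)) \<in> Z2"
proof -
  have C2: "c \<in> C2" and d: "d2 c = 0" using c by (auto simp: Z2_def)
  have T0: "T 0 = 0" using C1_D(3)[OF T, of 0 0] subspace_0[OF subspace_L] by simp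
  have "(\<lambda>x y. T (c x y)) \<in> C2"
    by (rule C2_I) (use C2 T0 in \<open>auto simp: C2_D[OF C2] C1_D[OF T]\<close>)
  moreover have "d2 (\<lambda>x y. T (c x y)) x y z = T (d2 c x y z)" for x y z
    using T0 by (simp add: d2_def comm C1_D[OF T] C2_D(1)[OF C2] br_closed
     subspace_diff[OF subspace_L] subspace_add[OF subspace_L])
  ultimately show ?thesis using d T0 by (simp add: Z2_def fun_eq_iff)
qed

end

section \<open>Symmetric 4 x 4 matrices with zero diagonal in characteristic 2\<close>

lemma commutator_F_nth:
  fixes X :: "'k::field^'n^'n"
  assumes "i \<noteq> j"
  shows "commutator (F i j) X $ a $ b =
    (if a = i then X $ j $ b else 0) + (if a = j then X $ i $ b else 0)
    - (if b = i then X $ a $ j else 0) - (if b = j then X $ a $ i else 0)"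
proof -
  have "(F i j ** X) $ a $ b = (if a = i then X $ j $ b else 0) + (if a = j then X $ i $ b else 0)"
    using assms by (simp add: matrix_matrix_mult_def F_nth distrib_right sum.distrib
        if_distrib[of "\<lambda>x. x * _"] cong: if_cong)
  moreover have "(X ** F i j) $ a $ b = (if b = i then X $ a $ j else 0) + (if b = j then X $ a $ i else 0)"
    using assms by (simp add: matrix_matrix_mult_def F_nth distrib_left sum.distrib
        if_distrib[of "\<lambda>x. _ * x"] cong: if_cong)
  ultimately show ?thesis by (simp add: commutator_def)
qed

lemma matrix_mult_linear:
  fixes A B C :: "'k::field^'n^'n"
  shows "A ** (B + C) = A ** B + A ** C" "(A + B) ** C = A ** C + B ** C"
    "A ** mscale r B = mscale r (A ** B)" "mscale r A ** B = mscale r (A ** B)"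
  by (simp_all add: matrix_matrix_mult_def mscale_def vec_eq_iff algebra_simps sum.distrib
      sum_distrib_left)

lemma E_unit_sandwich_nth: "(X ** E_unit v v ** Y) $ a $ b = X $ a $ v * Y $ v $ b"
proof -
  have "(X ** E_unit v v) $ a $ k = (if k = v then X $ a $ v else 0)" for k
    by (simp add: matrix_matrix_mult_def E_unit_def if_distrib[of "\<lambda>x. _ * x"] cong: if_cong)
  then show ?thesis
    by (simp add: matrix_matrix_mult_def[of "X ** E_unit v v"] if_distrib[of "\<lambda>x. x * _"] cong: if_cong)
qed

text \<open>
  The first-order term in \<open>t\<close> of the bracket \<open>X (1 + t D) Y - Y (1 + t D) X\<close>. For \<open>D = 1\<close> this is the
  bracket of the Lie algebra, which is the coboundary of the identity map; hence the classes of
  the four diagonal matrix units add up to 0.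
\<close>

definition twisted_bracket :: "'k::field^4^4 \<Rightarrow> 'k^4^4 \<Rightarrow> 'k^4^4 \<Rightarrow> 'k^4^4" where
  "twisted_bracket D X Y = (if X \<in> o_I1 \<and> Y \<in> o_I1 then X ** D ** Y - Y ** D ** X else 0)"

text \<open>
  The basis vector \<open>F i j\<close> goes to the \<open>F k l\<close> with \<open>{i, j, k, l} = {1, 2, 3, 4}\<close>, as under the Hodge
  star on bivectors in dimension 4.
\<close>

definition hodge :: "'k::field^4^4 \<Rightarrow> 'k^4^4" where
  "hodge X = (if X \<in> o_I1 then
     mscale (X$3$4) (F 1 2) + mscale (X$2$4) (F 1 3) + mscale (X$2$3) (F 1 4)
     + mscale (X$1$4) (F 2 3) + mscale (X$1$3) (F 2 4) + mscale (X$1$2) (F 3 4) else 0)"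

definition basis_map ::
    "'k::field^4^4 \<Rightarrow> 'k^4^4 \<Rightarrow> 'k^4^4 \<Rightarrow> 'k^4^4 \<Rightarrow> 'k^4^4 \<Rightarrow> 'k^4^4 \<Rightarrow> 'k^4^4 \<Rightarrow> 'k^4^4" where
  "basis_map v12 v13 v14 v23 v24 v34 X = (if X \<in> o_I1 then
     mscale (X$1$2) v12 + mscale (X$1$3) v13 + mscale (X$1$4) v14
     + mscale (X$2$3) v23 + mscale (X$2$4) v24 + mscale (X$3$4) v34 else 0)"

context
  assumes char2: "CHAR('k::field) = 2"
begin

text \<open>
  Signs are normalized away and equal summands cancelled by rewriting; the matrix versions make the
  cochain identities below accessible to plain simplification.
\<close>

lemma char2_simps [simp]:
  fixes x y :: 'k and X Y :: "'k^4^4"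
  shows "- x = x" "x - y = x + y" "x + x = 0" "x + (x + y) = y"
    "- X = X" "X - Y = X + Y" "X + X = 0" "X + (X + Y) = Y"
proof -
  show *: "- x = x" for x :: 'k using char2 by (rule uminus_CHAR_2)
  show "x - y = x + y" "x + x = 0" "x + (x + y) = y"
    using *[of x] *[of y]
    by (simp_all add: diff_conv_add_uminus add_eq_0_iff add.assoc[symmetric]
        del: add_uminus_conv_diff)
  show **: "- X = X" for X :: "'k^4^4" by (simp add: vec_eq_iff *)
  show "X - Y = X + Y" "X + X = 0" "X + (X + Y) = Y"
    using **[of X] **[of Y]
    by (simp_all add: diff_conv_add_uminus add_eq_0_iff add.assoc[symmetric]
        del: add_uminus_conv_diff)
qed

lemma char2_add_eq_0_iff: "A + B = 0 \<longleftrightarrow> A = B" for A B :: "'k^4^4"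
  by (simp add: add_eq_0_iff) auto

lemma char2_double: "2 * A = 0" for A :: "'k^4^4"
  by (simp add: mult_2)

lemma char2_two [simp]: "(2 :: 'k) = 0"
  by (metis char2_simps(3) one_add_one)

lemma char2_scalar_add_eq_0_iff: "a + b = 0 \<longleftrightarrow> a = b" for a b :: 'k
  by (simp add: add_eq_0_iff) auto

lemma o_I1_entries:
  fixes X :: "'k^4^4"
  assumes "X \<in> o_I1"
  shows "X$2$1 = X$1$2" "X$3$1 = X$1$3" "X$4$1 = X$1$4" "X$3$2 = X$2$3" "X$4$2 = X$2$4" "X$4$3 = X$3$4"
    "X$i$i = 0"
  using assms unfolding o_I1_eq[OF char2] by blast+

lemma o_I1_eqI:
  fixes X Y :: "'k^4^4"
  assumes "X \<in> o_I1" "Y \<in> o_I1"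
    and "X$1$2 = Y$1$2" "X$1$3 = Y$1$3" "X$1$4 = Y$1$4" "X$2$3 = Y$2$3" "X$2$4 = Y$2$4" "X$3$4 = Y$3$4"
  shows "X = Y"
  using assms by (simp add: vec_eq_iff forall_4 o_I1_entries)

lemma F_in_o_I1: "i \<noteq> j \<Longrightarrow> F i j \<in> (o_I1 :: ('k^4^4) set)"
  unfolding o_I1_eq[OF char2] by (auto simp: F_nth)

lemma F_bracket:
  "commutator (F 1 2) (F 1 3) = (F 2 3 :: 'k^4^4)" "commutator (F 1 2) (F 1 4) = (F 2 4 :: 'k^4^4)"
  "commutator (F 1 3) (F 1 4) = (F 3 4 :: 'k^4^4)" "commutator (F 1 2) (F 2 3) = (F 1 3 :: 'k^4^4)"
  "commutator (F 1 2) (F 2 4) = (F 1 4 :: 'k^4^4)" "commutator (F 2 3) (F 2 4) = (F 3 4 :: 'k^4^4)"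
  "commutator (F 1 3) (F 2 3) = (F 1 2 :: 'k^4^4)" "commutator (F 1 3) (F 3 4) = (F 1 4 :: 'k^4^4)"
  "commutator (F 2 3) (F 3 4) = (F 2 4 :: 'k^4^4)" "commutator (F 1 4) (F 2 4) = (F 1 2 :: 'k^4^4)"
  "commutator (F 1 4) (F 3 4) = (F 1 3 :: 'k^4^4)" "commutator (F 2 4) (F 3 4) = (F 2 3 :: 'k^4^4)"
  "commutator (F 1 2) (F 3 4) = (0 :: 'k^4^4)" "commutator (F 1 3) (F 2 4) = (0 :: 'k^4^4)"
  "commutator (F 1 4) (F 2 3) = (0 :: 'k^4^4)" "commutator (F i j) (F i j) = (0 :: 'k^4^4)"
  by (simp_all add: vec_eq_iff forall_4 commutator_F_nth F_nth) (simp add: commutator_def)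

lemma commutator_commute: "commutator Y X = (commutator X Y :: 'k^4^4)"
  by (simp add: commutator_def add.commute)

text \<open>Both orders of the arguments, so that every bracket of two basis vectors is rewritten.\<close>

lemmas F_brackets = F_bracket F_bracket[THEN trans[OF commutator_commute]]


section \<open>The six cochains are cocycles\<close>

text \<open>
  For symmetric \<open>X\<close>, \<open>Y\<close>, \<open>D\<close> the two products are transposes of each other, so their sum is
  symmetric and each diagonal entry occurs twice.
\<close>

lemma twisted_bracket_in_o_I1:
  fixes D X Y :: "'k^4^4"
  assumes D: "transpose D = D" and XY: "X \<in> o_I1" "Y \<in> o_I1"
  shows "X ** D ** Y - Y ** D ** X \<in> o_I1"
proof -
  have sym: "transpose X = X" "transpose Y = Y"
    using XY unfolding o_I1_eq[OF char2] vec_eq_iff transpose_def vec_lambda_beta by blast+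
  have transpose: "transpose (X ** D ** Y) = Y ** D ** X"
    by (simp add: matrix_transpose_mul sym D matrix_mul_assoc)
  have *: "(Y ** D ** X) $ i $ j = (X ** D ** Y) $ j $ i" for i j
    by (subst transpose[symmetric]) (simp add: transpose_def)
  show ?thesis
    unfolding o_I1_eq[OF char2]
    by (simp only: char2_simps mem_Collect_eq vector_add_component * add.commute simp_thms)
qed

text \<open>
  The cocycle identity is the linearization at \<open>D = 1\<close> of the Jacobi identity for \<open>X D Y - Y D X\<close>;
  after expansion the triple products cancel in pairs.
\<close>

lemma twisted_bracket_Z2:
  fixes D :: "'k^4^4"
  assumes D: "transpose D = D"
  shows "twisted_bracket D \<in> oI1.Z2"
proof -
  have C2: "twisted_bracket D \<in> oI1.C2"
  proof (rule oI1.C2_I, goal_cases)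
    case (1 X Y)
    then show ?case
      using twisted_bracket_in_o_I1[OF D] by (simp add: twisted_bracket_def del: char2_simps)
  qed (auto simp: twisted_bracket_def matrix_mult_linear mtx.subspace_add[OF oI1.subspace_L]
      mtx.subspace_scale[OF oI1.subspace_L] mtx.scale_right_distrib ac_simps)
  have "oI1.d2 (twisted_bracket D) X Y Z = 0"
    if L: "X \<in> o_I1" "Y \<in> o_I1" "Z \<in> o_I1" for X Y Z
    using L oI1.br_closed[OF L(1,2)] oI1.br_closed[OF L(1,3)] oI1.br_closed[OF L(2,3)]
    by (simp add: oI1.d2_def twisted_bracket_def commutator_def matrix_mult_linear matrix_mul_assoc ac_simps)
  then have "oI1.d2 (twisted_bracket D) = 0"
    by (intro ext) (simp add: oI1.d2_def)
  with C2 show ?thesis by (simp add: oI1.Z2_def)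
qed

lemma hodge_in_o_I1: "hodge X \<in> (o_I1 :: ('k^4^4) set)"
  by (auto simp: hodge_def mtx.subspace_0[OF oI1.subspace_L] F_in_o_I1
     intro!: mtx.subspace_add[OF oI1.subspace_L] mtx.subspace_scale[OF oI1.subspace_L])

lemma hodge_C1: "(hodge :: 'k^4^4 \<Rightarrow> 'k^4^4) \<in> oI1.C1"
proof -
  have "hodge (X + Y) = hodge X + hodge Y" "hodge (mscale r X) = mscale r (hodge X)"
    if "X \<in> o_I1" "Y \<in> o_I1" for X Y :: "'k^4^4" and r
    using that
    by (simp_all add: hodge_def mtx.subspace_add[OF oI1.subspace_L] mtx.subspace_scale[OF oI1.subspace_L])
      (simp_all add: vec_eq_iff forall_4 F_nth mscale_def)
  then show ?thesis
    by (simp add: oI1.C1_def oI1.linear_on_L_def hodge_in_o_I1) (simp add: hodge_def)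
qed

text \<open>
  With \<open>T = 1 + hodge\<close> acting as a scalar, the Lie algebra is the one with basis \<open>F 1 2\<close>, \<open>F 1 3\<close>,
  \<open>F 2 3\<close> and the cross product as bracket, over \<open>K[T]/(T\<^sup>2)\<close>.
\<close>

lemma hodge_centroid:
  fixes X Y :: "'k^4^4"
  assumes "X \<in> o_I1" "Y \<in> o_I1"
  shows "commutator X (hodge Y) = hodge (commutator X Y)"
proof (rule o_I1_eqI)
  show "commutator X (hodge Y) \<in> o_I1" "hodge (commutator X Y) \<in> o_I1"
    using assms by (simp_all add: oI1.br_closed hodge_in_o_I1)
qed (use assms oI1.br_closed[OF assms] in \<open>simp_all add: hodge_def commutator_def matrix_matrix_mult_def sum_4
       mscale_def F_nth o_I1_entries algebra_simps\<close>)

text \<open>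
  With \<open>D = E_unit v v\<close> the entry of \<open>X D Y + Y D X\<close> at \<open>(i, j)\<close> is \<open>X i v * Y v j + Y i v * X v j\<close>,
  so the cochain is the sum of \<open>F i j \<otimes> F_hat v i \<and> F_hat v j\<close> over the pairs \<open>{i, j}\<close> avoiding \<open>v\<close>.
\<close>

lemma c_eq_twisted_bracket:
  fixes X Y :: "'k^4^4"
  shows "c1 X Y = twisted_bracket (E_unit 2 2) X Y"
    and "c3 X Y = twisted_bracket (E_unit 3 3) X Y"
    and "c6 X Y = twisted_bracket (E_unit 4 4) X Y"
    and "c5 X Y = hodge (twisted_bracket (E_unit 1 1) X Y)"
    and "c4 X Y = hodge (twisted_bracket (E_unit 2 2) X Y)"
    and "c2 X Y = hodge (twisted_bracket (E_unit 3 3) X Y)"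
proof -
  have transpose: "transpose (E_unit v v) = (E_unit v v :: 'k^4^4)" for v
    by (auto simp: transpose_def E_unit_def vec_eq_iff)
  have hodge_0: "hodge 0 = (0 :: 'k^4^4)"
    by (simp add: hodge_def vec_eq_iff mscale_def)
  have outside: "F_hat i j X = 0" if "X \<notin> o_I1" for i j and X :: "'k^4^4"
    using that by (simp add: F_hat_def mtx.representation_def span_F_basis[OF char2])
  note simps = c1_def c2_def c3_def c4_def c5_def c6_def tensor_wedge_def twisted_bracket_def
  note inside_simps = simps hodge_def F_hat_eq[OF char2] E_unit_sandwich_nth
    twisted_bracket_in_o_I1[unfolded char2_simps] transpose vec_eq_iff forall_4 mscale_def F_nth
    o_I1_entries add.commute mult.commute
  show "c1 X Y = twisted_bracket (E_unit 2 2) X Y"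
    "c3 X Y = twisted_bracket (E_unit 3 3) X Y"
    "c6 X Y = twisted_bracket (E_unit 4 4) X Y"
    "c5 X Y = hodge (twisted_bracket (E_unit 1 1) X Y)"
    "c4 X Y = hodge (twisted_bracket (E_unit 2 2) X Y)"
    "c2 X Y = hodge (twisted_bracket (E_unit 3 3) X Y)"
    by (cases "X \<in> o_I1 \<and> Y \<in> o_I1"; (simp add: inside_simps; fail)?; auto simp: simps outside hodge_0)+
qed

lemma c_Z2: "{c1, c2, c3, c4, c5, c6} \<subseteq> (oI1.Z2 :: ('k^4^4 \<Rightarrow> 'k^4^4 \<Rightarrow> 'k^4^4) set)"
proof -
  have "transpose (E_unit v v) = (E_unit v v :: 'k^4^4)" for v
    by (auto simp: transpose_def E_unit_def vec_eq_iff)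
  then have "twisted_bracket (E_unit v v) \<in> (oI1.Z2 :: ('k^4^4 \<Rightarrow> 'k^4^4 \<Rightarrow> 'k^4^4) set)"
    and "(\<lambda>X Y. hodge (twisted_bracket (E_unit v v) X Y)) \<in> (oI1.Z2 :: ('k^4^4 \<Rightarrow> 'k^4^4 \<Rightarrow> 'k^4^4) set)" for v
    by (simp_all add: twisted_bracket_Z2 oI1.centroid_compose_Z2 hodge_C1 hodge_centroid)
  moreover have eqs: "c1 = (twisted_bracket (E_unit 2 2) :: 'k^4^4 \<Rightarrow> _)" "c3 = (twisted_bracket (E_unit 3 3) :: 'k^4^4 \<Rightarrow> _)"
    "c6 = (twisted_bracket (E_unit 4 4) :: 'k^4^4 \<Rightarrow> _)"
    "c5 = (\<lambda>X Y :: 'k^4^4. hodge (twisted_bracket (E_unit 1 1) X Y))"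
    "c4 = (\<lambda>X Y :: 'k^4^4. hodge (twisted_bracket (E_unit 2 2) X Y))"
    "c2 = (\<lambda>X Y :: 'k^4^4. hodge (twisted_bracket (E_unit 3 3) X Y))"
    by (intro ext c_eq_twisted_bracket)+
  ultimately show ?thesis
    unfolding eqs by simp
qed


section \<open>Cocycles determined by their values on relations\<close>

lemma basis_map_C1:
  fixes v12 v13 v14 v23 v24 v34 :: "'k^4^4"
  assumes "v12 \<in> o_I1" "v13 \<in> o_I1" "v14 \<in> o_I1" "v23 \<in> o_I1" "v24 \<in> o_I1" "v34 \<in> o_I1"
  shows "basis_map v12 v13 v14 v23 v24 v34 \<in> oI1.C1"
proof -
  have "basis_map v12 v13 v14 v23 v24 v34 (X + Y) = basis_map v12 v13 v14 v23 v24 v34 X + basis_map v12 v13 v14 v23 v24 v34 Y"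
    "basis_map v12 v13 v14 v23 v24 v34 (mscale r X) = mscale r (basis_map v12 v13 v14 v23 v24 v34 X)"
    if "X \<in> o_I1" "Y \<in> o_I1" for X Y :: "'k^4^4" and r
    using that
    by (simp_all add: basis_map_def mtx.subspace_add[OF oI1.subspace_L] mtx.subspace_scale[OF oI1.subspace_L])
      (simp_all add: vec_eq_iff mscale_def algebra_simps)
  moreover have "basis_map v12 v13 v14 v23 v24 v34 X \<in> o_I1" for X
    using assms by (simp add: basis_map_def mtx.subspace_add[OF oI1.subspace_L]
        mtx.subspace_scale[OF oI1.subspace_L] mtx.subspace_0[OF oI1.subspace_L])
  ultimately show ?thesis
    by (simp add: oI1.C1_def oI1.linear_on_L_def) (simp add: basis_map_def)
qed

lemma basis_map_F [simp]:
  fixes v12 v13 v14 v23 v24 v34 :: "'k^4^4"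
  shows "basis_map v12 v13 v14 v23 v24 v34 (F 1 2) = v12" "basis_map v12 v13 v14 v23 v24 v34 (F 1 3) = v13"
    "basis_map v12 v13 v14 v23 v24 v34 (F 1 4) = v14" "basis_map v12 v13 v14 v23 v24 v34 (F 2 3) = v23"
    "basis_map v12 v13 v14 v23 v24 v34 (F 2 4) = v24" "basis_map v12 v13 v14 v23 v24 v34 (F 3 4) = v34"
    "basis_map v12 v13 v14 v23 v24 v34 0 = 0"
  by (simp_all add: basis_map_def F_in_o_I1 F_nth)

lemma linear_eq_0_if_basis:
  fixes g :: "'k^4^4 \<Rightarrow> 'k^4^4"
  assumes g: "oI1.linear_on_L g" and X: "X \<in> o_I1"
    and "g (F 1 2) = 0" "g (F 1 3) = 0" "g (F 1 4) = 0" "g (F 2 3) = 0" "g (F 2 4) = 0" "g (F 3 4) = 0"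
  shows "g X = 0"
proof -
  have lin: "x \<in> o_I1 \<Longrightarrow> y \<in> o_I1 \<Longrightarrow> g (x + y) = g x + g y"
    "x \<in> o_I1 \<Longrightarrow> g (mscale r x) = mscale r (g x)" for x y r
    using g by (auto simp: oI1.linear_on_L_def)
  have "X = mscale (X$1$2) (F 1 2) + mscale (X$1$3) (F 1 3) + mscale (X$1$4) (F 1 4)
     + mscale (X$2$3) (F 2 3) + mscale (X$2$4) (F 2 4) + mscale (X$3$4) (F 3 4)"
    using X unfolding o_I1_eq[OF char2] by (intro F_basis_expansion) blast+
  then have "g X = g (mscale (X$1$2) (F 1 2) + mscale (X$1$3) (F 1 3) + mscale (X$1$4) (F 1 4)
     + mscale (X$2$3) (F 2 3) + mscale (X$2$4) (F 2 4) + mscale (X$3$4) (F 3 4))" by simp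
  also have "\<dots> = 0"
    using assms(3-) by (simp add: lin mtx.subspace_add[OF oI1.subspace_L]
        mtx.subspace_scale[OF oI1.subspace_L] F_in_o_I1)
  finally show ?thesis .
qed

lemma cochain_F_commute:
  fixes c :: "'k^4^4 \<Rightarrow> 'k^4^4 \<Rightarrow> 'k^4^4"
  assumes "c \<in> oI1.C2" "i \<noteq> j" "k \<noteq> l"
  shows "c (F i j) (F k l) = c (F k l) (F i j)"
  using oI1.C2_anticommute[OF assms(1)] assms by (simp add: F_in_o_I1)

text \<open>
  Rewrite rules that put the two basis vectors into lexicographic order and remove degenerate
  arguments.
\<close>

lemma cochain_F_order:
  fixes c :: "'k^4^4 \<Rightarrow> 'k^4^4 \<Rightarrow> 'k^4^4"
  assumes "c \<in> oI1.C2"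
  shows "c (F 1 3) (F 1 2) = c (F 1 2) (F 1 3)" "c (F 1 4) (F 1 2) = c (F 1 2) (F 1 4)"
    "c (F 2 3) (F 1 2) = c (F 1 2) (F 2 3)" "c (F 2 4) (F 1 2) = c (F 1 2) (F 2 4)"
    "c (F 3 4) (F 1 2) = c (F 1 2) (F 3 4)" "c (F 1 4) (F 1 3) = c (F 1 3) (F 1 4)"
    "c (F 2 3) (F 1 3) = c (F 1 3) (F 2 3)" "c (F 2 4) (F 1 3) = c (F 1 3) (F 2 4)"
    "c (F 3 4) (F 1 3) = c (F 1 3) (F 3 4)" "c (F 2 3) (F 1 4) = c (F 1 4) (F 2 3)"
    "c (F 2 4) (F 1 4) = c (F 1 4) (F 2 4)" "c (F 3 4) (F 1 4) = c (F 1 4) (F 3 4)"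
    "c (F 2 4) (F 2 3) = c (F 2 3) (F 2 4)" "c (F 3 4) (F 2 3) = c (F 2 3) (F 3 4)"
    "c (F 3 4) (F 2 4) = c (F 2 4) (F 3 4)"
  by (rule cochain_F_commute[OF assms]; simp)+

lemma cochain_F_degenerate:
  fixes c :: "'k^4^4 \<Rightarrow> 'k^4^4 \<Rightarrow> 'k^4^4"
  assumes "c \<in> oI1.C2" "i \<noteq> j"
  shows "c (F i j) (F i j) = 0" "c 0 (F i j) = 0"
  using assms by (simp_all add: oI1.C2_D(6) F_in_o_I1)

lemma cochain_eq_0_if_basis:
  fixes c :: "'k^4^4 \<Rightarrow> 'k^4^4 \<Rightarrow> 'k^4^4"
  assumes c: "c \<in> oI1.C2"
    and "c (F 1 2) (F 1 3) = 0" "c (F 1 2) (F 1 4) = 0" "c (F 1 2) (F 2 3) = 0" "c (F 1 2) (F 2 4) = 0"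
    "c (F 1 2) (F 3 4) = 0" "c (F 1 3) (F 1 4) = 0" "c (F 1 3) (F 2 3) = 0" "c (F 1 3) (F 2 4) = 0"
    "c (F 1 3) (F 3 4) = 0" "c (F 1 4) (F 2 3) = 0" "c (F 1 4) (F 2 4) = 0" "c (F 1 4) (F 3 4) = 0"
    "c (F 2 3) (F 2 4) = 0" "c (F 2 3) (F 3 4) = 0" "c (F 2 4) (F 3 4) = 0"
  shows "c = 0"
proof (intro ext)
  fix X Y :: "'k^4^4"
  have lin: "oI1.linear_on_L (c A)" "oI1.linear_on_L (\<lambda>B. c B A)" if "A \<in> o_I1" for A
    using c that by (auto simp: oI1.C2_def)
  have F: "c (F 1 2) B = 0" "c (F 1 3) B = 0" "c (F 1 4) B = 0" "c (F 2 3) B = 0" "c (F 2 4) B = 0"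
    "c (F 3 4) B = 0" if B: "B \<in> o_I1" for B
    by (rule linear_eq_0_if_basis[OF lin(1) B];
        simp add: assms(2-) F_in_o_I1 cochain_F_order[OF c] cochain_F_degenerate[OF c])+
  show "c X Y = 0 X Y"
  proof (cases "X \<in> o_I1 \<and> Y \<in> o_I1")
    case True
    then have "c X Y = 0"
      by (intro linear_eq_0_if_basis[OF lin(2), of Y X]) (auto simp: F)
    then show ?thesis by simp
  qed (use oI1.C2_D(7,8)[OF c] in auto)
qed

lemma cocycle_identity:
  fixes c :: "'k^4^4 \<Rightarrow> 'k^4^4 \<Rightarrow> 'k^4^4"
  assumes "c \<in> oI1.Z2" "X \<in> o_I1" "Y \<in> o_I1" "Z \<in> o_I1"
  shows "commutator X (c Y Z) + commutator Y (c X Z) + commutator Z (c X Y)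
    + c (commutator X Y) Z + c (commutator X Z) Y + c (commutator Y Z) X = 0"
proof -
  have "oI1.d2 c X Y Z = 0" using assms(1) by (simp add: oI1.Z2_def)
  then show ?thesis using assms by (simp add: oI1.d2_def)
qed

text \<open>
  The remaining seven pairs are reached by the cocycle identity on triples of basis vectors. It gives
  two of the values at once, expresses the others through \<open>w = c (F 1 3) (F 2 4)\<close> and
  \<open>v = c (F 1 4) (F 3 4)\<close>, and shows that \<open>w\<close> is killed by \<open>ad (F 2 3)\<close> and \<open>(ad (F 1 2))\<^sup>2\<close> and then
  that \<open>v\<close> commutes with \<open>F 1 2\<close> and \<open>F 2 3\<close>. Only 0 has these properties: \<open>ad (F i j)\<close> exchanges
  in pairs the four basis vectors that have exactly one index in \<open>{i, j}\<close>, so its kernel, like that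
  of its square, is spanned by \<open>F i j\<close> and the complementary \<open>F k l\<close>.
\<close>

lemma cocycle_eq_0_if_relations:
  fixes c :: "'k^4^4 \<Rightarrow> 'k^4^4 \<Rightarrow> 'k^4^4"
  assumes c: "c \<in> oI1.Z2"
    and zeros: "c (F 1 2) (F 2 3) = 0" "c (F 2 3) (F 3 4) = 0" "c (F 1 2) (F 2 4) = 0"
    "c (F 1 2) (F 3 4) = 0" "c (F 1 2) (F 1 3) = 0" "c (F 1 3) (F 2 3) = 0"
    "c (F 2 3) (F 2 4) = 0" "c (F 2 4) (F 3 4) = 0"
  shows "c = 0"
proof -
  have C2: "c \<in> oI1.C2" using c by (simp add: oI1.Z2_def)
  have in_L [simp]: "c (F i j) (F k l) \<in> o_I1" if "i \<noteq> j" "k \<noteq> l" for i j k l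
    using that by (simp add: oI1.C2_D(1)[OF C2] F_in_o_I1)
  note identity = cocycle_identity[OF c F_in_o_I1 F_in_o_I1 F_in_o_I1]
  note simps = F_brackets F_in_o_I1 cochain_F_order[OF C2] cochain_F_degenerate[OF C2]
    char2_add_eq_0_iff zeros
  let ?w = "c (F 1 3) (F 2 4)" and ?v = "c (F 1 4) (F 3 4)"
  have z1: "c (F 1 3) (F 3 4) = 0"
    using identity[of 1 2 2 3 3 4] by (simp add: simps)
  have z2: "c (F 1 2) (F 1 4) = 0"
    using identity[of 1 2 1 3 3 4] by (simp add: simps z1)
  note simps' = simps z1 z2
  have e1: "c (F 1 4) (F 2 3) = ?w"
    using identity[of 1 2 2 3 2 4] by (simp add: simps')
  have e2: "c (F 1 3) (F 1 4) = commutator (F 1 2) ?w"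
    using identity[of 1 2 1 3 2 4] by (simp add: simps')
  have e3: "c (F 1 4) (F 2 4) = commutator (F 3 4) ?w"
    using identity[of 1 3 2 4 3 4] by (simp add: simps')
  have "commutator (F 2 3) ?w = 0"
    using identity[of 1 3 2 3 2 4] by (simp add: simps')
  moreover have "commutator (F 1 2) (commutator (F 1 2) ?w) = 0"
    using identity[of 1 2 1 3 1 4] by (simp add: simps' e1 e2 char2_double)
  ultimately have w: "?w = 0"
    by (intro o_I1_eqI mtx.subspace_0[OF oI1.subspace_L])
      (simp_all add: vec_eq_iff forall_4 commutator_F_nth o_I1_entries)
  have "commutator (F 1 2) ?v = 0"
    using identity[of 1 2 1 4 3 4] by (simp add: simps')
  moreover have "commutator (F 2 3) ?v = 0"
    using identity[of 1 4 2 3 3 4] by (simp add: simps' e1 e3 w)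
  ultimately have v: "?v = 0"
    by (intro o_I1_eqI mtx.subspace_0[OF oI1.subspace_L])
      (simp_all add: vec_eq_iff forall_4 commutator_F_nth o_I1_entries)
  show ?thesis
    by (rule cochain_eq_0_if_basis[OF C2]) (simp_all add: simps' e1 e2 e3 v w)
qed

text \<open>
  The five values have 30 coordinates; 18 linear relations between them come from four vector
  equations, each a consequence of cocycle identities. With \<open>r1\<close>, \<dots>, \<open>r5\<close> for the five values in the
  order of the statement, they are \<open>[F 1 2, r3] = [F 2 3, r2]\<close>, \<open>[F 2 3, r5] = [F 3 4, r4]\<close>,
  \<open>[F 1 2, r4] = [F 3 4, r3] + [F 2 3, [F 2 3, r1]]\<close>, and
  \<open>[F 1 3, r4] + [F 2 4, r3] \<in> [F 2 3, \<gg>]\<close>.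
\<close>

lemma normalized_cocycle_relations:
  fixes c :: "'k^4^4 \<Rightarrow> 'k^4^4 \<Rightarrow> 'k^4^4"
  assumes c: "c \<in> oI1.Z2"
    and zeros: "c (F 1 2) (F 2 3) = 0" "c (F 2 3) (F 3 4) = 0" "c (F 1 2) (F 2 4) = 0"
  obtains p x t w u v z y m n s q where
    "c (F 1 2) (F 3 4) = mscale (p + x) (F 2 4) + mscale (t + w) (F 1 3) + mscale u (F 2 3) + mscale v (F 1 4)"
    "c (F 1 2) (F 1 3) = mscale x (F 1 2) + mscale w (F 3 4) + mscale z (F 2 3) + mscale y (F 1 4)"
    "c (F 1 3) (F 2 3) = mscale m (F 1 2) + mscale n (F 3 4) + mscale x (F 2 3) + mscale w (F 1 4)"
    "c (F 2 3) (F 2 4) = mscale n (F 1 2) + mscale m (F 3 4) + mscale t (F 2 3) + mscale p (F 1 4)"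
    "c (F 2 4) (F 3 4) = mscale p (F 1 2) + mscale t (F 3 4) + mscale s (F 2 3) + mscale q (F 1 4)"
proof -
  have C2: "c \<in> oI1.C2" using c by (simp add: oI1.Z2_def)
  have in_L [simp]: "c (F i j) (F k l) \<in> o_I1" if "i \<noteq> j" "k \<noteq> l" for i j k l
    using that by (simp add: oI1.C2_D(1)[OF C2] F_in_o_I1)
  note identity = cocycle_identity[OF c F_in_o_I1 F_in_o_I1 F_in_o_I1]
  note simps = F_brackets F_in_o_I1 cochain_F_order[OF C2] cochain_F_degenerate[OF C2]
    char2_add_eq_0_iff zeros
  define r1 r2 r3 r4 r5 where r: "r1 = c (F 1 2) (F 3 4)" "r2 = c (F 1 2) (F 1 3)"
    "r3 = c (F 1 3) (F 2 3)" "r4 = c (F 2 3) (F 2 4)" "r5 = c (F 2 4) (F 3 4)"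
  have r_in [simp]: "r1 \<in> o_I1" "r2 \<in> o_I1" "r3 \<in> o_I1" "r4 \<in> o_I1" "r5 \<in> o_I1"
    by (simp_all add: r)
  have z: "c (F 1 3) (F 3 4) = commutator (F 2 3) r1"
    using identity[of 1 2 2 3 3 4] by (simp add: simps r)
  have e1: "commutator (F 1 2) r3 = commutator (F 2 3) r2"
    using identity[of 1 2 1 3 2 3] by (simp add: simps r)
  have e2: "commutator (F 2 3) r5 = commutator (F 3 4) r4"
    using identity[of 2 3 2 4 3 4] by (simp add: simps r)
  \<comment> \<open>The stars at the vertices 2 and 3 involve the same cyclic sum of values on complementary pairs.\<close>
  have "commutator (F 1 2) r4 + (r1 + c (F 1 3) (F 2 4) + c (F 1 4) (F 2 3)) = 0"
    using identity[of 1 2 2 3 2 4] by (simp add: simps r ac_simps)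
  moreover have "commutator (F 3 4) r3 + commutator (F 2 3) (commutator (F 2 3) r1)
      + (r1 + c (F 1 3) (F 2 4) + c (F 1 4) (F 2 3)) = 0"
    using identity[of 1 3 2 3 3 4] unfolding z by (simp add: simps r ac_simps)
  ultimately have e3: "commutator (F 1 2) r4 = commutator (F 3 4) r3 + commutator (F 2 3) (commutator (F 2 3) r1)"
    by (simp only: char2_add_eq_0_iff)
  have e4: "commutator (F 1 3) r4 + commutator (F 2 4) r3 = commutator (F 2 3) (r1 + c (F 1 3) (F 2 4))"
    using identity[of 1 3 2 3 2 4] by (simp add: simps r z ac_simps commutator_linear)
  have rel1: "r2$1$3 = 0" "r2$2$4 = 0" "r3$1$3 = 0" "r3$2$4 = 0" "r3$2$3 = r2$1$2" "r3$1$4 = r2$3$4"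
    using e1 by (simp_all add: vec_eq_iff forall_4 commutator_F_nth o_I1_entries)
  have rel2: "r4$1$3 = 0" "r4$2$4 = 0" "r5$1$3 = 0" "r5$2$4 = 0" "r5$1$2 = r4$1$4" "r5$3$4 = r4$2$3"
    using e2 by (simp_all add: vec_eq_iff forall_4 commutator_F_nth o_I1_entries)
  have rel3: "r1$1$2 = 0" "r1$3$4 = 0" "r1$2$4 = r4$1$4 + r2$1$2" "r1$1$3 = r4$2$3 + r2$3$4"
    using e3 by (simp_all add: vec_eq_iff forall_4 commutator_F_nth o_I1_entries rel1)
  \<comment> \<open>The right-hand side of \<open>e4\<close> has no \<open>F 1 4\<close> and no \<open>F 2 3\<close> coordinate, whatever \<open>c (F 1 3) (F 2 4)\<close> is.\<close>
  have rel4: "r4$3$4 = r3$1$2" "r4$1$2 = r3$3$4"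
    using e4 by (simp_all add: vec_eq_iff forall_4 commutator_F_nth o_I1_entries char2_scalar_add_eq_0_iff)
  show thesis
    by (rule that[of "r4$1$4" "r2$1$2" "r4$2$3" "r2$3$4" "r1$2$3" "r1$1$4" "r2$2$3" "r2$1$4"
          "r3$1$2" "r3$3$4" "r5$2$3" "r5$1$4"]; unfold r[symmetric])
      (simp_all add: vec_eq_iff forall_4 mscale_def F_nth o_I1_entries rel1 rel2 rel3 rel4)
qed


section \<open>Every cocycle is cohomologous to a combination of the six\<close>

lemma coboundary_F:
  fixes f :: "'k^4^4 \<Rightarrow> 'k^4^4"
  assumes "i \<noteq> j" "k \<noteq> l"
  shows "oI1.d1 f (F i j) (F k l) = commutator (F i j) (f (F k l)) + commutator (F k l) (f (F i j))
     + f (commutator (F i j) (F k l))"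
  using assms by (simp add: oI1.d1_def F_in_o_I1)

lemma exists_normalizing_coboundary:
  fixes c :: "'k^4^4 \<Rightarrow> 'k^4^4 \<Rightarrow> 'k^4^4"
  assumes c: "c \<in> oI1.Z2"
  obtains f where "f \<in> oI1.C1" "(c + oI1.d1 f) (F 1 2) (F 2 3) = 0"
    "(c + oI1.d1 f) (F 2 3) (F 3 4) = 0" "(c + oI1.d1 f) (F 1 2) (F 2 4) = 0"
proof -
  have in_L [simp]: "c (F i j) (F k l) \<in> o_I1" if "i \<noteq> j" "k \<noteq> l" for i j k l
    using c that by (simp add: oI1.Z2_def oI1.C2_D(1) F_in_o_I1)
  \<comment> \<open>The second summand in the value at \<open>F 1 4\<close> compensates for the value at \<open>F 2 4\<close>.\<close>
  define f where "f = basis_map 0 (c (F 1 2) (F 2 3))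
    (c (F 1 2) (F 2 4) + commutator (F 1 2) (c (F 2 3) (F 3 4))) 0 (c (F 2 3) (F 3 4)) 0"
  have "f \<in> oI1.C1"
    unfolding f_def by (rule basis_map_C1) (simp_all add: mtx.subspace_0[OF oI1.subspace_L]
        mtx.subspace_add[OF oI1.subspace_L] oI1.br_closed F_in_o_I1)
  then show thesis
    by (rule that)
      (simp_all add: coboundary_F F_brackets, simp_all add: f_def char2_double oI1.br_zero F_in_o_I1)
qed

lemma commutator_zero: "commutator X 0 = (0 :: 'k^4^4)"
  by (simp add: commutator_def)

lemma c_on_relations:
  shows
    "c1 (F 1 2) (F 2 3) = (F 1 3 :: 'k^4^4)" "c1 (F 2 3) (F 3 4) = (0 :: 'k^4^4)"
    "c1 (F 1 2) (F 2 4) = (F 1 4 :: 'k^4^4)" "c1 (F 1 2) (F 3 4) = (0 :: 'k^4^4)"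
    "c1 (F 1 2) (F 1 3) = (0 :: 'k^4^4)" "c1 (F 1 3) (F 2 3) = (0 :: 'k^4^4)"
    "c1 (F 2 3) (F 2 4) = (F 3 4 :: 'k^4^4)" "c1 (F 2 4) (F 3 4) = (0 :: 'k^4^4)"
    "c2 (F 1 2) (F 2 3) = (0 :: 'k^4^4)" "c2 (F 2 3) (F 3 4) = (F 1 3 :: 'k^4^4)"
    "c2 (F 1 2) (F 2 4) = (0 :: 'k^4^4)" "c2 (F 1 2) (F 3 4) = (0 :: 'k^4^4)"
    "c2 (F 1 2) (F 1 3) = (0 :: 'k^4^4)" "c2 (F 1 3) (F 2 3) = (F 3 4 :: 'k^4^4)"
    "c2 (F 2 3) (F 2 4) = (0 :: 'k^4^4)" "c2 (F 2 4) (F 3 4) = (0 :: 'k^4^4)"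
    "c3 (F 1 2) (F 2 3) = (0 :: 'k^4^4)" "c3 (F 2 3) (F 3 4) = (F 2 4 :: 'k^4^4)"
    "c3 (F 1 2) (F 2 4) = (0 :: 'k^4^4)" "c3 (F 1 2) (F 3 4) = (0 :: 'k^4^4)"
    "c3 (F 1 2) (F 1 3) = (0 :: 'k^4^4)" "c3 (F 1 3) (F 2 3) = (F 1 2 :: 'k^4^4)"
    "c3 (F 2 3) (F 2 4) = (0 :: 'k^4^4)" "c3 (F 2 4) (F 3 4) = (0 :: 'k^4^4)"
    "c4 (F 1 2) (F 2 3) = (F 2 4 :: 'k^4^4)" "c4 (F 2 3) (F 3 4) = (0 :: 'k^4^4)"
    "c4 (F 1 2) (F 2 4) = (F 2 3 :: 'k^4^4)" "c4 (F 1 2) (F 3 4) = (0 :: 'k^4^4)"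
    "c4 (F 1 2) (F 1 3) = (0 :: 'k^4^4)" "c4 (F 1 3) (F 2 3) = (0 :: 'k^4^4)"
    "c4 (F 2 3) (F 2 4) = (F 1 2 :: 'k^4^4)" "c4 (F 2 4) (F 3 4) = (0 :: 'k^4^4)"
    "c5 (F 1 2) (F 2 3) = (0 :: 'k^4^4)" "c5 (F 2 3) (F 3 4) = (0 :: 'k^4^4)"
    "c5 (F 1 2) (F 2 4) = (0 :: 'k^4^4)" "c5 (F 1 2) (F 3 4) = (0 :: 'k^4^4)"
    "c5 (F 1 2) (F 1 3) = (F 1 4 :: 'k^4^4)" "c5 (F 1 3) (F 2 3) = (0 :: 'k^4^4)"
    "c5 (F 2 3) (F 2 4) = (0 :: 'k^4^4)" "c5 (F 2 4) (F 3 4) = (0 :: 'k^4^4)"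
    "c6 (F 1 2) (F 2 3) = (0 :: 'k^4^4)" "c6 (F 2 3) (F 3 4) = (0 :: 'k^4^4)"
    "c6 (F 1 2) (F 2 4) = (0 :: 'k^4^4)" "c6 (F 1 2) (F 3 4) = (0 :: 'k^4^4)"
    "c6 (F 1 2) (F 1 3) = (0 :: 'k^4^4)" "c6 (F 1 3) (F 2 3) = (0 :: 'k^4^4)"
    "c6 (F 2 3) (F 2 4) = (0 :: 'k^4^4)" "c6 (F 2 4) (F 3 4) = (F 2 3 :: 'k^4^4)"
  by (simp_all add: c1_def c2_def c3_def c4_def c5_def c6_def tensor_wedge_def
      F_hat_eq[OF char2] F_in_o_I1 F_nth)

text \<open>
  After normalization it remains to find a combination \<open>S\<close> of the six cocycles and a 1-cochain \<open>g\<close>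
  such that \<open>c' + S + d1 g\<close> vanishes on the three defining pairs and the five relations; it is then
  zero by \<open>cocycle_eq_0_if_relations\<close>.
\<close>

lemma cocycle_cohomologous_to_combination:
  fixes c :: "'k^4^4 \<Rightarrow> 'k^4^4 \<Rightarrow> 'k^4^4"
  assumes c: "c \<in> oI1.Z2"
  obtains a1 a2 a3 a4 a5 a6 b where "b \<in> oI1.B2"
    "c = (\<lambda>X Y. mscale a1 (c1 X Y)) + (\<lambda>X Y. mscale a2 (c2 X Y)) + (\<lambda>X Y. mscale a3 (c3 X Y))
       + (\<lambda>X Y. mscale a4 (c4 X Y)) + (\<lambda>X Y. mscale a5 (c5 X Y)) + (\<lambda>X Y. mscale a6 (c6 X Y)) + b"
proof -
  obtain f where f: "f \<in> oI1.C1" and zeros: "(c + oI1.d1 f) (F 1 2) (F 2 3) = 0"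
    "(c + oI1.d1 f) (F 2 3) (F 3 4) = 0" "(c + oI1.d1 f) (F 1 2) (F 2 4) = 0"
    using exists_normalizing_coboundary[OF c] .
  define c' where "c' = c + oI1.d1 f"
  have c': "c' \<in> oI1.Z2"
    using c f by (simp add: c'_def oI1.Z2_add oI1.d1_in_Z2)
  note zeros = zeros[folded c'_def]
  from normalized_cocycle_relations[OF c' zeros]
  obtain p x t w u v z y m n s q where rel:
    "c' (F 1 2) (F 3 4) = mscale (p + x) (F 2 4) + mscale (t + w) (F 1 3) + mscale u (F 2 3) + mscale v (F 1 4)"
    "c' (F 1 2) (F 1 3) = mscale x (F 1 2) + mscale w (F 3 4) + mscale z (F 2 3) + mscale y (F 1 4)"
    "c' (F 1 3) (F 2 3) = mscale m (F 1 2) + mscale n (F 3 4) + mscale x (F 2 3) + mscale w (F 1 4)"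
    "c' (F 2 3) (F 2 4) = mscale n (F 1 2) + mscale m (F 3 4) + mscale t (F 2 3) + mscale p (F 1 4)"
    "c' (F 2 4) (F 3 4) = mscale p (F 1 2) + mscale t (F 3 4) + mscale s (F 2 3) + mscale q (F 1 4)" .
  \<comment> \<open>After normalization, \<open>c1\<close> contributes to \<open>z, m\<close>, \<open>c2\<close> to \<open>q, n\<close>, \<open>c3\<close> to \<open>m, s\<close>, \<open>c4\<close> to \<open>y, n\<close>,
    \<open>c5\<close> to \<open>y\<close> and \<open>c6\<close> to \<open>s\<close>; this is the solution of the resulting triangular system.\<close>
  define a1 a2 a3 a4 a5 a6 where a: "a1 = z" "a2 = q" "a3 = m + z" "a4 = n + q" "a5 = y + n + q" "a6 = s + m + z"
  define S where "S = (\<lambda>X Y. mscale a1 (c1 X Y)) + (\<lambda>X Y. mscale a2 (c2 X Y)) + (\<lambda>X Y. mscale a3 (c3 X Y))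
       + (\<lambda>X Y. mscale a4 (c4 X Y)) + (\<lambda>X Y. mscale a5 (c5 X Y)) + (\<lambda>X Y. mscale a6 (c6 X Y))"
  \<comment> \<open>On the generators \<open>F 1 2\<close>, \<open>F 3 4\<close> the values cancel \<open>x, w\<close> and \<open>p, t, u, v\<close>. The values at
    \<open>F 1 3\<close>, \<open>F 2 4\<close>, \<open>F 1 4\<close> are then forced by normalization; \<open>a1\<close>, \<dots>, \<open>a4\<close> enter because
    \<open>c1\<close>, \<dots>, \<open>c4\<close> are not normalized.\<close>
  define g where "g = basis_map
     (mscale x (F 2 3) + mscale w (F 1 4))
     (mscale a1 (F 1 3) + mscale a4 (F 2 4))
     (mscale x (F 3 4) + mscale w (F 1 2) + mscale (a1 + a3) (F 1 4) + mscale (a2 + a4) (F 2 3))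
     0
     (mscale u (F 1 2) + mscale v (F 3 4) + mscale a2 (F 1 3) + mscale a3 (F 2 4))
     (mscale p (F 1 4) + mscale t (F 2 3) + mscale u (F 1 3) + mscale v (F 2 4))"
  have g: "g \<in> oI1.C1"
    unfolding g_def
    by (rule basis_map_C1) (simp_all add: F_in_o_I1 mtx.subspace_0[OF oI1.subspace_L]
        mtx.subspace_add[OF oI1.subspace_L] mtx.subspace_scale[OF oI1.subspace_L])
  have S: "S \<in> oI1.Z2"
    using c_Z2 unfolding S_def by (intro oI1.Z2_add oI1.Z2_scale) auto
  have "c' + S + oI1.d1 g = 0"
  proof (rule cocycle_eq_0_if_relations)
    show "c' + S + oI1.d1 g \<in> oI1.Z2"
      by (intro oI1.Z2_add oI1.d1_in_Z2 c' S g)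
  qed (simp_all add: zeros rel S_def a c_on_relations coboundary_F F_brackets g_def
      commutator_linear commutator_zero mtx.scale_left_distrib mtx.scale_right_distrib ac_simps)
  then have "c X Y + oI1.d1 f X Y + S X Y + oI1.d1 g X Y = 0" for X Y
    by (simp add: c'_def fun_eq_iff)
  then have "c X Y + (S X Y + (oI1.d1 f X Y + oI1.d1 g X Y)) = 0" for X Y
    by (simp add: ac_simps)
  then have "c X Y = S X Y + (oI1.d1 f X Y + oI1.d1 g X Y)" for X Y
    unfolding char2_add_eq_0_iff .
  then have "c = S + (oI1.d1 f + oI1.d1 g)"
    by (simp add: fun_eq_iff)
  moreover have "oI1.d1 f + oI1.d1 g \<in> oI1.B2"
    using f g by (intro oI1.B2_add) (auto simp: oI1.B2_def)
  ultimately show thesis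
    unfolding S_def using that by blast
qed

end

theorem lemma9p8:
  assumes "CHAR('k::alg_closed_field) = 2"
  shows "{c1, c2, c3, c4, c5, c6} \<subseteq> (oI1.Z2 :: ('k^4^4 \<Rightarrow> 'k^4^4 \<Rightarrow> 'k^4^4) set) \<and>
    (oI1.H2 :: ('k^4^4 \<Rightarrow> 'k^4^4 \<Rightarrow> 'k^4^4) set set) =
      oI1.H2_span (oI1.cohomology_class ` {c1, c2, c3, c4, c5, c6})"
    (is "?C \<subseteq> _ \<and> _ = oI1.H2_span ?S")
proof (intro conjI subset_antisym)
  show Z2: "?C \<subseteq> oI1.Z2"
    using assms by (rule c_Z2)
  show "oI1.H2_span ?S \<subseteq> oI1.H2"
    using Z2 by (rule oI1.H2_span_subset_H2)
  show "(oI1.H2 :: ('k^4^4 \<Rightarrow> 'k^4^4 \<Rightarrow> 'k^4^4) set set) \<subseteq> oI1.H2_span ?S"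
  proof
    fix A :: "('k^4^4 \<Rightarrow> 'k^4^4 \<Rightarrow> 'k^4^4) set"
    assume "A \<in> oI1.H2"
    then obtain c where c: "c \<in> oI1.Z2" and A: "A = oI1.cohomology_class c"
      by (auto simp: oI1.H2_def)
    obtain a1 a2 a3 a4 a5 a6 b where b: "b \<in> oI1.B2" and c_eq:
      "c = (\<lambda>X Y. mscale a1 (c1 X Y)) + (\<lambda>X Y. mscale a2 (c2 X Y)) + (\<lambda>X Y. mscale a3 (c3 X Y))
       + (\<lambda>X Y. mscale a4 (c4 X Y)) + (\<lambda>X Y. mscale a5 (c5 X Y)) + (\<lambda>X Y. mscale a6 (c6 X Y)) + b"
      using cocycle_cohomologous_to_combination[OF assms c] .
    show "A \<in> oI1.H2_span ?S"
      unfolding A c_eq oI1.cohomology_class_add_coboundary[OF b]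
      by (intro oI1.class_add_in_H2_span oI1.class_scale_in_H2_span oI1.H2_span.base imageI) simp_all
  qed
qed

end
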